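(* Let $G$ be a cubic graph with a (proper) $3$-edge-colouring $c$, and let $\{e_1,e_2,e_3\}$ be an edge-triple of $G$. If there is a prune-path or a prune-tree for $\{e_1,e_2,e_3\}$ (with respect to the colouring $c$), then the graph obtained by applying the tripod operation to $\{e_1,e_2,e_3\}$ is $3$-edge-colourable.
   Context: Graphs are finite and simple; a cubic graph is a $3$-regular graph. An edge-triple is a set of $3$ different edges (they may share vertices). The tripod operation applied to an edge-triple $\{e_1,e_2,e_3\}$ of a cubic graph subdivides each $e_i$ with a new vertex $v_i$ and adds one new vertex adjacent to $v_1,v_2,v_3$. Edge-colourings are proper and use colours $1,2,3$. Let $\{c_1,c_2,c_3\}=\{1,2,3\}$. In a $3$-edge-coloured cubic graph, a $(c_1,c_2)$-path from an edge $e$ coloured $c_1$ to an edge $e'$ is a path starting with the edge $e$ and ending with the edge $e'$ that contains only edges with colours $c_1$ and $c_2$ (the colour of $e'$ can be either $c_1$ or $c_2$); in particular its first edge has colour $c_1$. The same notation is used for any ordered pair of distinct colours. A prune-path for $\{e_1,e_2,e_3\}$ is a path from $e_1$ to $e_3$ (starting with edge $e_1$ and ending with edge $e_3$) containing $e_2$, such that, for some $c_1,c_2,c_3$ with $\{c_1,c_2,c_3\}=\{1,2,3\}$, the path contains a $(c_2,c_1)$-path from $e_2$ to $e_1$ and a $(c_2,c_3)$-path from $e_2$ to $e_3$. A prune-tree for $\{e_1,e_2,e_3\}$ is a subgraph $T$ that is a tree with $3$ leaves, these leaves being contained in the edges $e_1,e_2,e_3$ (one in each), such that $e_1$ also contains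 the unique vertex $v$ of degree $3$ of $T$ and, for some $c_1,c_2,c_3$ with $\{c_1,c_2,c_3\}=\{1,2,3\}$: $e_1$ is coloured $c_1$, the path in $T$ starting in the vertex $v$ and ending with the edge $e_2$ is a $(c_2,c_1)$-path (first edge, at $v$, coloured $c_2$), and the path in $T$ starting in the vertex $v$ and ending with the edge $e_3$ is a $(c_3,c_2)$-path (first edge, at $v$, coloured $c_3$). *)

theory Defs
  imports Main
begin

record 'a graph =
  verts :: "'a set"
  edges :: "'a set set"

definition simple_graph :: "'a graph \<Rightarrow> bool" where
  "simple_graph G \<longleftrightarrow>
     finite (verts G) \<and> (\<forall>e\<in>edges G. e \<subseteq> verts G \<and> card e = 2)"

definition degree :: "'a graph \<Rightarrow> 'a \<Rightarrow> nat" where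
  "degree G v = card {e \<in> edges G. v \<in> e}"

definition cubic_graph :: "'a graph \<Rightarrow> bool" where
  "cubic_graph G \<longleftrightarrow> simple_graph G \<and> (\<forall>v\<in>verts G. degree G v = 3)"

definition subgraph :: "'a graph \<Rightarrow> 'a graph \<Rightarrow> bool" where
  "subgraph H G \<longleftrightarrow>
     simple_graph H \<and> verts H \<subseteq> verts G \<and> edges H \<subseteq> edges G"

text \<open>Paths are given by their lists of (pairwise distinct) vertices.\<close>

fun walk_edges :: "'a list \<Rightarrow> 'a set list" where
  "walk_edges (x # y # xs) = {x, y} # walk_edges (y # xs)"
| "walk_edges _ = []"

definition path :: "'a graph \<Rightarrow> 'a list \<Rightarrow> bool" where
  "path G p \<longleftrightarrow>
     p \<noteq> [] \<and> distinct p \<and> set p \<subseteq> verts G \<and> set (walk_edges p) \<subseteq> edges G"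

definition connected_graph :: "'a graph \<Rightarrow> bool" where
  "connected_graph G \<longleftrightarrow> verts G \<noteq> {} \<and>
     (\<forall>u\<in>verts G. \<forall>v\<in>verts G. \<exists>p. path G p \<and> hd p = u \<and> last p = v)"

definition acyclic_graph :: "'a graph \<Rightarrow> bool" where
  "acyclic_graph G \<longleftrightarrow>
     \<not> (\<exists>p. path G p \<and> length p \<ge> 3 \<and> {last p, hd p} \<in> edges G)"

definition tree :: "'a graph \<Rightarrow> bool" where
  "tree G \<longleftrightarrow> simple_graph G \<and> connected_graph G \<and> acyclic_graph G"

definition leaves :: "'a graph \<Rightarrow> 'a set" where
  "leaves G = {v \<in> verts G. degree G v = 1}"

definition three_edge_colouring :: "'a graph \<Rightarrow> ('a set \<Rightarrow> nat) \<Rightarrow> bool" where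
  "three_edge_colouring G c \<longleftrightarrow>
     (\<forall>e\<in>edges G. c e \<in> {1, 2, 3}) \<and>
     (\<forall>e\<in>edges G. \<forall>f\<in>edges G. e \<noteq> f \<and> e \<inter> f \<noteq> {} \<longrightarrow> c e \<noteq> c f)"

definition three_edge_colourable :: "'a graph \<Rightarrow> bool" where
  "three_edge_colourable G \<longleftrightarrow> (\<exists>c. three_edge_colouring G c)"

definition edge_triple :: "'a graph \<Rightarrow> 'a set set \<Rightarrow> bool" where
  "edge_triple G S \<longleftrightarrow> S \<subseteq> edges G \<and> card S = 3"

text \<open>
  In the graph after the tripod operation, \<open>Sub e\<close> is the vertex subdividing
  the edge \<open>e\<close> of the triple and \<open>Hub\<close> is the vertex adjacent to the three
  subdividing vertices.
\<close>

datatype 'a tripod_vertex = Old 'a | Sub "'a set" | Hub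

definition tripod :: "'a graph \<Rightarrow> 'a set set \<Rightarrow> 'a tripod_vertex graph" where
  "tripod G S = \<lparr>
     verts = Old ` verts G \<union> Sub ` S \<union> {Hub},
     edges = {Old ` e | e. e \<in> edges G - S}
           \<union> {{Old x, Sub e} | x e. e \<in> S \<and> x \<in> e}
           \<union> {{Sub e, Hub} | e. e \<in> S} \<rparr>"

text \<open>
  A path with at least one edge, all of whose edges have colour \<open>a\<close> or \<open>b\<close>,
  and whose first edge has colour \<open>a\<close>.
\<close>

definition bicoloured_path ::
    "'a graph \<Rightarrow> ('a set \<Rightarrow> nat) \<Rightarrow> nat \<Rightarrow> nat \<Rightarrow> 'a list \<Rightarrow> bool" where
  "bicoloured_path G c a b p \<longleftrightarrow>
     path G p \<and> walk_edges p \<noteq> [] \<and> c (hd (walk_edges p)) = a \<and>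
     (\<forall>e\<in>set (walk_edges p). c e = a \<or> c e = b)"

definition path_from_to :: "'a list \<Rightarrow> 'a set \<Rightarrow> 'a set \<Rightarrow> bool" where
  "path_from_to p e f \<longleftrightarrow>
     walk_edges p \<noteq> [] \<and> hd (walk_edges p) = e \<and> last (walk_edges p) = f"

definition prune_path ::
    "'a graph \<Rightarrow> ('a set \<Rightarrow> nat) \<Rightarrow> 'a set set \<Rightarrow> 'a list \<Rightarrow> bool" where
  "prune_path G c S p \<longleftrightarrow>
     (\<exists>e1 e2 e3. S = {e1, e2, e3} \<and>
        path G p \<and> path_from_to p e1 e3 \<and> e2 \<in> set (walk_edges p) \<and>
        (\<exists>c1 c2 c3. {c1, c2, c3} = {1, 2, 3} \<and>
           (\<exists>q. bicoloured_path G c c2 c1 q \<and> path_from_to q e2 e1 \<and>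
                set (walk_edges q) \<subseteq> set (walk_edges p)) \<and>
           (\<exists>r. bicoloured_path G c c2 c3 r \<and> path_from_to r e2 e3 \<and>
                set (walk_edges r) \<subseteq> set (walk_edges p))))"

definition prune_tree ::
    "'a graph \<Rightarrow> ('a set \<Rightarrow> nat) \<Rightarrow> 'a set set \<Rightarrow> 'a graph \<Rightarrow> bool" where
  "prune_tree G c S T \<longleftrightarrow>
     (\<exists>e1 e2 e3. S = {e1, e2, e3} \<and>
        subgraph T G \<and> tree T \<and> card (leaves T) = 3 \<and>
        (\<exists>l1 l2 l3. leaves T = {l1, l2, l3} \<and> l1 \<in> e1 \<and> l2 \<in> e2 \<and> l3 \<in> e3) \<and>
        (\<exists>v. {x \<in> verts T. degree T x = 3} = {v} \<and> v \<in> e1 \<and>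
           (\<exists>c1 c2 c3. {c1, c2, c3} = {1, 2, 3} \<and> c e1 = c1 \<and>
              (\<exists>q. bicoloured_path T c c2 c1 q \<and> hd q = v \<and> last (walk_edges q) = e2) \<and>
              (\<exists>r. bicoloured_path T c c3 c2 r \<and> hd r = v \<and> last (walk_edges r) = e3))))"

end

(* Recolour G vertex by vertex: at each vertex x the colours are permuted by some \<pi> x. This keeps
   the three edges at x distinct, and gives a colouring of the tripod graph if the two ends of every
   edge outside the triple agree and the two ends of the edges of the triple disagree, leaving three
   different colours for the edges at the hub. On a prune-path, \<pi> swaps c1 and c2 at the inner
   vertices up to e2 and c2 and c3 at the inner vertices behind e2. On a prune-tree, \<pi> swaps c1
   and c2 at the inner vertices of the path to e2, c2 and c3 at those of the path to e3, and does
   both, one after the other, at the vertex of degree 3. *)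

theory Submission
  imports Defs "HOL-Combinatorics.Transposition"
begin

section \<open>Recolouring by permutations at the vertices\<close>

text \<open>A half \<open>{Old x, Sub e}\<close> gets the colour \<open>\<pi> x (c e)\<close> and
  the hub edge of \<open>e\<close> gets \<open>d e\<close>. Injectivity of \<open>\<pi> x\<close>
  separates edges at \<open>Old x\<close>, \<open>differ\<close> and \<open>hub\<close> separate
  them at \<open>Sub e\<close>, and injectivity of \<open>d\<close> at \<open>Hub\<close>.\<close>

lemma tripod_colourableI:
  assumes "three_edge_colouring G c" "S \<subseteq> edges G" "{} \<notin> edges G"
    and perm: "\<And>x. bij_betw (\<pi> x) {1,2,3} {1,2,3::nat}"
    and agree: "\<And>e x y. e \<in> edges G - S \<Longrightarrow> x \<in> e \<Longrightarrow> y \<in> e \<Longrightarrow> \<pi> x (c e) = \<pi> y (c e)"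
    and differ: "\<And>e x y. e \<in> S \<Longrightarrow> x \<in> e \<Longrightarrow> y \<in> e \<Longrightarrow> x \<noteq> y \<Longrightarrow> \<pi> x (c e) \<noteq> \<pi> y (c e)"
    and hub: "\<And>e x. e \<in> S \<Longrightarrow> x \<in> e \<Longrightarrow> \<pi> x (c e) \<noteq> d e"
    and d: "inj_on d S" "d ` S \<subseteq> {1,2,3}"
  shows "three_edge_colourable (tripod G S)"
proof -
  have range: "\<pi> x (c e) \<in> {1,2,3}" if "e \<in> edges G" for x e
    using perm assms(1) that unfolding three_edge_colouring_def by (metis bij_betwE)
  have proper: "\<pi> x (c e) \<noteq> \<pi> x (c f)"
    if "e \<in> edges G" "f \<in> edges G" "e \<noteq> f" "x \<in> e" "x \<in> f" for x e f
  proof -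
    have "c e \<in> {1,2,3}" "c f \<in> {1,2,3}" "c e \<noteq> c f"
      using assms(1) that unfolding three_edge_colouring_def by blast+
    then show ?thesis
      using perm[of x] by (metis bij_betw_imp_inj_on inj_onD)
  qed
  \<comment> \<open>The kind of an edge is read off from the vertices in it. The choice of an end in
    the last branch is harmless, since by \<open>agree\<close> all ends of an old edge yield the
    same colour.\<close>
  define c' where "c' F =
    (if Hub \<in> F then d (THE e. Sub e \<in> F)
     else if \<exists>e. Sub e \<in> F then \<pi> (THE x. Old x \<in> F) (c (THE e. Sub e \<in> F))
     else \<pi> (SOME x. Old x \<in> F) (c (Old -` F)))" for F
  have c'_hub: "c' {Sub e, Hub} = d e" for e
    by (simp add: c'_def)
  have c'_sub: "c' {Old x, Sub e} = \<pi> x (c e)" for x e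
    by (auto simp: c'_def)
  have c'_old: "c' (Old ` e) = \<pi> x (c e)" if "e \<in> edges G - S" "x \<in> e" for x e
  proof -
    have "(SOME x. x \<in> e) \<in> e" using that by (metis someI)
    moreover have "Old -` Old ` e = e" by auto
    moreover have "(\<lambda>x. Old x \<in> Old ` e) = (\<lambda>x. x \<in> e)" by auto
    ultimately show ?thesis
      using agree[OF that(1) _ that(2)] by (auto simp: c'_def)
  qed
  have "(\<exists>e. F = Old ` e \<and> e \<in> edges G - S) \<or> (\<exists>x e. F = {Old x, Sub e} \<and> e \<in> S \<and> x \<in> e)
      \<or> (\<exists>e. F = {Sub e, Hub} \<and> e \<in> S)" if "F \<in> edges (tripod G S)" for F
    using that unfolding tripod_def by auto
  then have edge_cases [consumes 1]: thesis
    if "F \<in> edges (tripod G S)"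
      and "\<And>e. F = Old ` e \<Longrightarrow> e \<in> edges G - S \<Longrightarrow> thesis"
      and "\<And>x e. F = {Old x, Sub e} \<Longrightarrow> e \<in> S \<Longrightarrow> x \<in> e \<Longrightarrow> thesis"
      and "\<And>e. F = {Sub e, Hub} \<Longrightarrow> e \<in> S \<Longrightarrow> thesis" for F thesis
    using that by metis
  have "c' F \<in> {1,2,3}" if "F \<in> edges (tripod G S)" for F
    using that
  proof (cases rule: edge_cases)
    case (1 e)
    then obtain x where "x \<in> e" using assms(3) by (metis DiffD1 ex_in_conv)
    then show ?thesis using 1 c'_old range by auto
  qed (use d range assms(2) in \<open>auto simp: c'_hub c'_sub simp del: insert_iff\<close>)
  moreover have "c' F \<noteq> c' F'"
    if F: "F \<in> edges (tripod G S)" and F': "F' \<in> edges (tripod G S)"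
      and ne: "F \<noteq> F'" and meet: "F \<inter> F' \<noteq> {}" for F F'
    using F
  proof (cases rule: edge_cases)
    case (1 e)
    note e = this
    from F' show ?thesis
    proof (cases rule: edge_cases)
      case (1 f)
      with e meet obtain x where "x \<in> e" "x \<in> f" by auto
      with 1 e ne show ?thesis using c'_old[of e x] c'_old[of f x] proper[of e f x] by auto
    next
      case (2 x f)
      with e meet have "x \<in> e" by auto
      \<comment> \<open>Here \<open>e\<close> lies outside the triple and \<open>f\<close> in it, so
        they are different edges at \<open>x\<close>.\<close>
      with 2 e show ?thesis using c'_old[of e x] c'_sub[of x f] proper[of e f x] assms(2) by auto
    next
      case (3 f)
      with e meet show ?thesis by auto
    qed
  next
    case (2 x e)
    note e = this
    from F' show ?thesis
    proof (cases rule: edge_cases)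
      case (1 f)
      with e meet have "x \<in> f" by auto
      with 1 e show ?thesis using c'_old[of f x] c'_sub[of x e] proper[of e f x] assms(2) by auto
    next
      case (2 y f)
      show ?thesis
      \<comment> \<open>Two halves of one edge meet in its subdividing vertex; halves of different
        edges can meet only in an old vertex.\<close>
      proof (cases "e = f")
        case True
        with 2 e ne show ?thesis using differ[of e x y] by (auto simp: c'_sub)
      next
        case False
        with 2 e meet have "x = y" by auto
        with 2 e False show ?thesis using proper[of e f x] assms(2) by (auto simp: c'_sub)
      qed
    next
      case (3 f)
      with e meet show ?thesis using hub by (auto simp: c'_sub c'_hub)
    qed
  next
    case (3 e)
    note e = this
    from F' show ?thesis
    proof (cases rule: edge_cases)
      case (1 f)
      with e meet show ?thesis by auto
    next
      case (2 y f)
      with e meet show ?thesis using hub[of f y] by (auto simp: c'_sub c'_hub)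
    next
      case (3 f)
      with e ne show ?thesis using d(1) by (auto simp: c'_hub inj_on_def)
    qed
  qed
  ultimately show ?thesis
    unfolding three_edge_colourable_def three_edge_colouring_def by blast
qed

section \<open>Edges of walks and their positions\<close>

lemma length_walk_edges: "length (walk_edges p) = length p - 1"
  by (induction p rule: walk_edges.induct) auto

lemma nth_walk_edges: "Suc i < length p \<Longrightarrow> walk_edges p ! i = {p ! i, p ! Suc i}"
proof (induction p arbitrary: i rule: walk_edges.induct)
  case (1 x y xs)
  then show ?case by (cases i) auto
qed auto

lemma set_walk_edges: "set (walk_edges p) = {{p ! i, p ! Suc i} | i. Suc i < length p}"
proof -
  have "i < length (walk_edges p) \<longleftrightarrow> Suc i < length p" for i
    by (auto simp: length_walk_edges)
  then show ?thesis
    by (auto simp: set_conv_nth nth_walk_edges) (metis nth_walk_edges)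
qed

lemma walk_edges_memI: "Suc i < length p \<Longrightarrow> {p ! i, p ! Suc i} \<in> set (walk_edges p)"
  by (auto simp: set_walk_edges)

lemma hd_walk_edges: "walk_edges p \<noteq> [] \<Longrightarrow> hd (walk_edges p) = {p ! 0, p ! 1}"
  by (cases p rule: walk_edges.cases) auto

lemma last_walk_edges:
  "Suc (Suc n) = length p \<Longrightarrow> last (walk_edges p) = {p ! n, p ! Suc n}"
  using length_walk_edges[of p] nth_walk_edges[of n p]
  by (metis One_nat_def diff_Suc_1 last_conv_nth lessI list.size(3) nat.distinct(1))

text \<open>Consecutive edges of \<open>q\<close> have positions in \<open>p\<close> differing by at most one, so these positions
  run through every value between the first and the last one.\<close>

lemma walk_edges_between:
  assumes "distinct p" "Suc k < length p" "Suc m < length p"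
    and "set (walk_edges q) \<subseteq> set (walk_edges p)" "walk_edges q \<noteq> []"
    and "hd (walk_edges q) = {p ! k, p ! Suc k}" "last (walk_edges q) = {p ! m, p ! Suc m}"
    and "min k m \<le> i" "i \<le> max k m"
  shows "{p ! i, p ! Suc i} \<in> set (walk_edges q)"
  using assms(2,4-9)
proof (induction q arbitrary: k rule: walk_edges.induct)
  case (1 x y xs)
  show ?case
  proof (cases xs)
    case Nil
    then have "{p ! k, p ! Suc k} = {p ! m, p ! Suc m}" using 1 by simp
    then have "k = m"
      using assms(1,3) 1(2) by (auto simp: doubleton_eq_iff nth_eq_iff_index_eq)
    then show ?thesis using 1 Nil by auto
  next
    case (Cons z zs)
    have "{y, z} \<in> set (walk_edges p)" using 1 Cons by auto
    then obtain k' where k': "Suc k' < length p" "{y, z} = {p ! k', p ! Suc k'}"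
      by (auto simp: set_walk_edges)
    \<comment> \<open>The walk turns from one edge into the next at \<open>y\<close>, and edges of a
      path that share a vertex are equal or neighbours.\<close>
    have "y \<in> {p ! k, p ! Suc k}" "y \<in> {p ! k', p ! Suc k'}"
      using 1(5) by (auto simp flip: k'(2))
    then have "k' = k \<or> k' = Suc k \<or> k = Suc k'"
      using assms(1) k'(1) 1(2) by (auto simp: nth_eq_iff_index_eq)
    \<comment> \<open>Moving from \<open>k\<close> to \<open>k'\<close> can drop only
      \<open>k\<close> itself from the range towards \<open>m\<close>.\<close>
    then have "i = k \<or> min k' m \<le> i \<and> i \<le> max k' m"
      using 1(7,8) by auto
    then show ?thesis
    proof
      assume "i = k"
      then show ?thesis using 1(5) by auto
    next
      assume "min k' m \<le> i \<and> i \<le> max k' m"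
      then have "{p ! i, p ! Suc i} \<in> set (walk_edges (y # xs))"
        using 1(3,6) Cons k' by (intro 1(1)[of k']) auto
      then show ?thesis by simp
    qed
  qed
qed auto

section \<open>Colours at the inner vertices of a path\<close>

text \<open>Consecutive edges of a path are different and meet, so their colours differ and use up
  both \<open>a\<close> and \<open>b\<close>.\<close>

lemma interior_colours:
  assumes "three_edge_colouring G c" "path G p" "Suc (Suc i) < length p"
    and "c {p ! i, p ! Suc i} \<in> {a, b}" "c {p ! Suc i, p ! Suc (Suc i)} \<in> {a, b}"
  shows "{c {p ! i, p ! Suc i}, c {p ! Suc i, p ! Suc (Suc i)}} = {a, b}"
proof -
  have "{p ! i, p ! Suc i} \<noteq> {p ! Suc i, p ! Suc (Suc i)}"
    using assms(2,3) unfolding path_def by (auto simp: doubleton_eq_iff nth_eq_iff_index_eq)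
  moreover have "{p ! j, p ! Suc j} \<in> edges G" if "Suc j < length p" for j
    using assms(2) that unfolding path_def by (auto simp: set_walk_edges)
  ultimately have "c {p ! i, p ! Suc i} \<noteq> c {p ! Suc i, p ! Suc (Suc i)}"
    using assms(1,3) unfolding three_edge_colouring_def by auto
  then show ?thesis using assms(4,5) by auto
qed

text \<open>The two path edges at an inner vertex already carry \<open>a\<close> and
  \<open>b\<close>. Hence swapping these colours there does not affect an edge off the path.\<close>

lemma off_path_colour:
  assumes "three_edge_colouring G c" "path G p" "Suc (Suc i) < length p"
    and "c {p ! i, p ! Suc i} \<in> {a, b}" "c {p ! Suc i, p ! Suc (Suc i)} \<in> {a, b}"
    and "e \<in> edges G" "p ! Suc i \<in> e" "e \<notin> set (walk_edges p)"
  shows "c e \<notin> {a, b}"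
proof -
  have "c e \<noteq> c f" if "f \<in> set (walk_edges p)" "p ! Suc i \<in> f" for f
  proof -
    have "f \<in> edges G" "e \<noteq> f" "e \<inter> f \<noteq> {}"
      using that assms(2,7,8) unfolding path_def by auto
    then show ?thesis using assms(1,6) unfolding three_edge_colouring_def by blast
  qed
  then have "c e \<noteq> c {p ! i, p ! Suc i}" "c e \<noteq> c {p ! Suc i, p ! Suc (Suc i)}"
    using walk_edges_memI[of i p] walk_edges_memI[of "Suc i" p] assms(3) by auto
  then show ?thesis using interior_colours[OF assms(1-5)] by blast
qed

text \<open>This is the shape of \<open>\<pi> x\<close> in both recolourings below, with
  \<open>P\<close> and \<open>Q\<close> for membership of \<open>x\<close> in the sets of vertices
  where a swap applies.\<close>

lemma bij_betw_transposes:
  assumes "{c1, c2, c3} = {1, 2, 3::nat}"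
  shows "bij_betw ((if P then transpose c2 c3 else id) \<circ> (if Q then transpose c1 c2 else id))
    {1,2,3} {1,2,3}"
proof -
  have "bij_betw (transpose a b) {1,2,3} {1,2,3}" if "a \<in> {1,2,3}" "b \<in> {1,2,3}" for a b :: nat
    using that by (intro bij_betw_byWitness[where f' = "transpose a b"]) (auto simp: transpose_def)
  moreover have "c1 \<in> {1,2,3}" "c2 \<in> {1,2,3}" "c3 \<in> {1,2,3}" using assms by auto
  ultimately show ?thesis by (intro bij_betw_trans[where B = "{1,2,3}"]) auto
qed

lemma distinct_colours:
  assumes "{c1, c2, c3} = {1, 2, 3::nat}"
  shows "c1 \<noteq> c2" "c1 \<noteq> c3" "c2 \<noteq> c3"
proof -
  have "card {c1, c2, c3} = 3" using assms by simp
  then show "c1 \<noteq> c2" "c1 \<noteq> c3" "c2 \<noteq> c3"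
    by (auto simp: card_insert_if split: if_splits)
qed

section \<open>Recolouring along a prune-path\<close>

text \<open>Along the path \<open>\<pi>\<close> changes exactly at the edges of the triple. The
  halves of \<open>e1\<close>, \<open>e2\<close>, \<open>e3\<close> get the colours
  \<open>{c1, c2}\<close>, \<open>{c1, c3}\<close> and \<open>{c2, c3}\<close>, which leaves
  \<open>c3\<close>, \<open>c2\<close>, \<open>c1\<close> for the hub.\<close>

lemma prune_path_colourable:
  assumes G: "simple_graph G" and c: "three_edge_colouring G c" and S: "edge_triple G S"
    and p: "prune_path G c S p"
  shows "three_edge_colourable (tripod G S)"
proof -
  obtain e1 e2 e3 c1 c2 c3 q r where Seq: "S = {e1, e2, e3}" and path: "path G p"
    and p13: "path_from_to p e1 e3" and e2p: "e2 \<in> set (walk_edges p)"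
    and cs: "{c1, c2, c3} = {1, 2, 3}"
    and q: "bicoloured_path G c c2 c1 q" "path_from_to q e2 e1" "set (walk_edges q) \<subseteq> set (walk_edges p)"
    and r: "bicoloured_path G c c2 c3 r" "path_from_to r e2 e3" "set (walk_edges r) \<subseteq> set (walk_edges p)"
    using p unfolding prune_path_def by blast
  note ne = distinct_colours[OF cs]
  have en: "e1 \<noteq> e2" "e1 \<noteq> e3" "e2 \<noteq> e3"
    using S Seq unfolding edge_triple_def by (auto simp: card_insert_if split: if_splits)
  have dist: "distinct p" using path unfolding path_def by blast
  obtain k where k: "Suc k < length p" "e2 = {p ! k, p ! Suc k}"
    using e2p by (auto simp: set_walk_edges)
  \<comment> \<open>The index of the last edge of \<open>p\<close>.\<close>
  define n where "n = length p - 2"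
  have len: "length p = Suc (Suc n)" using k n_def by auto
  have wne: "walk_edges p \<noteq> []" using e2p by auto
  have e1: "e1 = {p ! 0, p ! Suc 0}" using p13 hd_walk_edges[OF wne] unfolding path_from_to_def by simp
  have e3: "e3 = {p ! n, p ! Suc n}" using p13 last_walk_edges[OF len[symmetric]] unfolding path_from_to_def by simp
  have "k \<noteq> 0" "k \<noteq> n" using en(1,3) e1 e3 k(2) by metis+
  then have kn: "0 < k" "k < n" using k(1) len by auto
  have col1: "c {p ! i, p ! Suc i} \<in> {c1, c2}" if "i \<le> k" for i
  proof -
    \<comment> \<open>As \<open>q\<close> uses only edges of \<open>p\<close>, it must run through
      all those between \<open>e2\<close> and \<open>e1\<close>, which therefore have its two
      colours.\<close>
    have "{p ! i, p ! Suc i} \<in> set (walk_edges q)"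
      using walk_edges_between[OF dist k(1), of 0 q i] q e1 k len that unfolding path_from_to_def by auto
    then show ?thesis using q(1) unfolding bicoloured_path_def by auto
  qed
  have col3: "c {p ! i, p ! Suc i} \<in> {c2, c3}" if "k \<le> i" "i \<le> n" for i
  proof -
    have "{p ! i, p ! Suc i} \<in> set (walk_edges r)"
      using walk_edges_between[OF dist k(1), of n r i] r e3 k len that unfolding path_from_to_def by auto
    then show ?thesis using r(1) unfolding bicoloured_path_def by auto
  qed
  \<comment> \<open>The edge \<open>e2\<close> belongs to both stretches, and \<open>c2\<close> is
    the only colour they share.\<close>
  have c_e2: "c e2 = c2" using col1[of k] col3[of k] ne k kn by auto
  \<comment> \<open>The positions \<open>1\<close> to \<open>k\<close> and \<open>k + 1\<close> to
    \<open>n\<close>: both ends of the path are left out, and \<open>e2\<close> joins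
    \<open>A\<close> to \<open>B\<close>.\<close>
  define A where "A = {p ! Suc i | i. i < k}"
  define B where "B = {p ! Suc i | i. k \<le> i \<and> i < n}"
  have inA: "p ! j \<in> A \<longleftrightarrow> 0 < j \<and> j \<le> k" if "j < length p" for j
    using that dist k unfolding A_def
    by (auto simp: nth_eq_iff_index_eq) (metis Suc_le_lessD Suc_pred)
  have inB: "p ! j \<in> B \<longleftrightarrow> k < j \<and> j \<le> n" if "j < length p" for j
    using that dist len unfolding B_def
    by (auto simp: nth_eq_iff_index_eq) (metis Suc_le_lessD Suc_less_eq Suc_pred less_Suc_eq_le gr0I not_less0)
  define \<pi> where "\<pi> x = (if x \<in> B then transpose c2 c3 else id) \<circ> (if x \<in> A then transpose c1 c2 else id)" for x
  have fixed: "\<pi> x (c e) = c e" if e: "e \<in> edges G" "e \<notin> set (walk_edges p)" "x \<in> e" for x e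
  proof -
    have "c e \<notin> {c1, c2}" if xA: "x \<in> A"
    proof -
      obtain i where i: "i < k" "x = p ! Suc i" using xA A_def by auto
      then show ?thesis
        using off_path_colour[OF c path, of i c1 c2 e] e col1[of i] col1[of "Suc i"] kn len by simp
    qed
    moreover have "c e \<notin> {c2, c3}" if xB: "x \<in> B"
    proof -
      obtain i where i: "k \<le> i" "i < n" "x = p ! Suc i" using xB B_def by auto
      then show ?thesis
        using off_path_colour[OF c path, of i c2 c3 e] e col3[of i] col3[of "Suc i"] kn len by simp
    qed
    ultimately show ?thesis by (auto simp: \<pi>_def transpose_def)
  qed
  show ?thesis
  proof (rule tripod_colourableI[OF c, where \<pi> = \<pi>
        and d = "\<lambda>e. if e = e1 then c3 else if e = e2 then c2 else c1"])
    show "S \<subseteq> edges G" using S unfolding edge_triple_def by blast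
    show "{} \<notin> edges G" using G unfolding simple_graph_def by force
    show "bij_betw (\<pi> x) {1,2,3} {1,2,3}" for x unfolding \<pi>_def by (rule bij_betw_transposes[OF cs])
    show "\<pi> x (c e) = \<pi> y (c e)" if e: "e \<in> edges G - S" "x \<in> e" "y \<in> e" for e x y
    proof (cases "e \<in> set (walk_edges p)")
      case True
      then obtain i where i: "Suc i < length p" "e = {p ! i, p ! Suc i}" by (auto simp: set_walk_edges)
      \<comment> \<open>The excluded positions are those of the triple; at any other one both ends
        lie in \<open>A\<close> or both in \<open>B\<close>.\<close>
      with e(1) Seq e1 e3 k len have "i \<noteq> 0" "i \<noteq> k" "i \<noteq> n" by auto
      with inA[of i] inA[of "Suc i"] inB[of i] inB[of "Suc i"] i len
      have "\<pi> (p ! i) = \<pi> (p ! Suc i)" by (auto simp: \<pi>_def)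
      then show ?thesis using e i by auto
    next
      case False
      then show ?thesis using fixed e by auto
    qed
    have e1l: "\<pi> (p ! 0) (c e1) = c e1" "\<pi> (p ! Suc 0) (c e1) = transpose c1 c2 (c e1)"
      using inA[of 0] inA[of "Suc 0"] inB[of 0] inB[of "Suc 0"] kn
      unfolding len by (simp_all add: \<pi>_def)
    have e2l: "\<pi> (p ! k) (c e2) = c1" "\<pi> (p ! Suc k) (c e2) = c3"
      using inA[of k] inA[of "Suc k"] inB[of k] inB[of "Suc k"] kn len c_e2 by (auto simp: \<pi>_def)
    have e3l: "\<pi> (p ! n) (c e3) = transpose c2 c3 (c e3)" "\<pi> (p ! Suc n) (c e3) = c e3"
      using inA[of n] inA[of "Suc n"] inB[of n] inB[of "Suc n"] kn len by (auto simp: \<pi>_def)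
    have ce: "c e1 \<in> {c1, c2}" "c e3 \<in> {c2, c3}"
      using col1[of 0] col3[of n] e1 e3 kn by auto
    show "\<pi> x (c e) \<noteq> \<pi> y (c e)" if e: "e \<in> S" "x \<in> e" "y \<in> e" "x \<noteq> y" for e x y
    proof -
      consider "e = e1" | "e = e2" | "e = e3" using e(1) Seq by auto
      then show ?thesis
      proof cases
        case 1
        then have "{x, y} = {p ! 0, p ! Suc 0}" using e e1 by auto
        then show ?thesis using e1l ce 1 ne by (auto simp: doubleton_eq_iff)
      next
        case 2
        then have "{x, y} = {p ! k, p ! Suc k}" using e k by auto
        then show ?thesis using e2l 2 ne by (auto simp: doubleton_eq_iff)
      next
        case 3
        then have "{x, y} = {p ! n, p ! Suc n}" using e e3 by auto
        then show ?thesis using e3l ce 3 ne by (auto simp: doubleton_eq_iff)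
      qed
    qed
    show "\<pi> x (c e) \<noteq> (if e = e1 then c3 else if e = e2 then c2 else c1)"
      if e: "e \<in> S" "x \<in> e" for e x
    proof -
      consider "e = e1" "x = p ! 0 \<or> x = p ! Suc 0" | "e = e2" "x = p ! k \<or> x = p ! Suc k"
        | "e = e3" "x = p ! n \<or> x = p ! Suc n" using e Seq e1 k e3 by blast
      then show ?thesis using e1l e2l e3l ce ne en by cases auto
    qed
    show "inj_on (\<lambda>e. if e = e1 then c3 else if e = e2 then c2 else c1) S"
      using Seq ne by (auto simp: inj_on_def)
    show "(\<lambda>e. if e = e1 then c3 else if e = e2 then c2 else c1) ` S \<subseteq> {1,2,3}"
      using cs by auto
  qed
qed

section \<open>Recolouring along a prune-tree\<close>

lemma walk_edges_length:
  assumes "walk_edges p \<noteq> []"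
  obtains n where "length p = Suc (Suc n)"
  using assms by (cases p rule: walk_edges.cases) auto

text \<open>The two swaps at \<open>v\<close> compose to the cycle \<open>c1\<close> to
  \<open>c3\<close> to \<open>c2\<close> to \<open>c1\<close>. On the first edges of
  \<open>q\<close> and \<open>r\<close> it acts like the single swap of that path, while
  \<open>e1\<close> gets \<open>c3\<close> at \<open>v\<close> and keeps \<open>c1\<close> at its
  leaf.\<close>

lemma prune_tree_colourable:
  assumes G: "cubic_graph G" and c: "three_edge_colouring G c" and S: "edge_triple G S"
    and T: "prune_tree G c S T"
  shows "three_edge_colourable (tripod G S)"
proof -
  obtain e1 e2 e3 l1 l2 l3 v c1 c2 c3 q r where Seq: "S = {e1, e2, e3}" and sub: "subgraph T G"
    and lv: "leaves T = {l1, l2, l3}" "l1 \<in> e1" "l2 \<in> e2" "l3 \<in> e3"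
    and v: "{x \<in> verts T. degree T x = 3} = {v}" "v \<in> e1"
    and cs: "{c1, c2, c3} = {1, 2, 3}" and ce1: "c e1 = c1"
    and q: "bicoloured_path T c c2 c1 q" "hd q = v" "last (walk_edges q) = e2"
    and r: "bicoloured_path T c c3 c2 r" "hd r = v" "last (walk_edges r) = e3"
    using T unfolding prune_tree_def by blast
  note ne = distinct_colours[OF cs]
  have en: "e1 \<noteq> e2" "e1 \<noteq> e3" "e2 \<noteq> e3"
    using S Seq unfolding edge_triple_def by (auto simp: card_insert_if split: if_splits)
  have SG: "S \<subseteq> edges G" using S unfolding edge_triple_def by blast
  have TG: "verts T \<subseteq> verts G" "edges T \<subseteq> edges G" using sub unfolding subgraph_def by auto
  have "finite (verts G)" "edges G \<subseteq> Pow (verts G)"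
    using G unfolding cubic_graph_def simple_graph_def by auto
  then have fin: "finite (edges G)" by (metis finite_Pow_iff finite_subset)
  have c2card: "card e = 2" if "e \<in> edges G" for e
    using that G unfolding cubic_graph_def simple_graph_def by auto
  have deg_G: "card {e \<in> edges G. x \<in> e} = 3" if "x \<in> verts T" for x
    using that TG G unfolding cubic_graph_def degree_def by auto
  have deg_le: "degree T x \<le> 3" if "x \<in> verts T" for x
  proof -
    have "card {e \<in> edges T. x \<in> e} \<le> card {e \<in> edges G. x \<in> e}"
      using TG fin by (intro card_mono) auto
    then show ?thesis using deg_G[OF that] by (simp add: degree_def)
  qed
  \<comment> \<open>Edges of different colours are different, so colours seen at a vertex bound its
    degree from below.\<close>
  have deg_ge: "card C \<le> degree T x" if "C \<subseteq> c ` {e \<in> edges T. x \<in> e}" for C x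
  proof -
    have "finite {e \<in> edges T. x \<in> e}" using TG fin by (auto intro: finite_subset)
    then show ?thesis using that unfolding degree_def by (rule surj_card_le)
  qed
  have pathT: "path T q" "path T r" and qr_ne: "walk_edges q \<noteq> []" "walk_edges r \<noteq> []"
    using q r unfolding bicoloured_path_def by auto
  then have pathG: "path G q" "path G r" using TG unfolding path_def by auto
  obtain m n where len: "length q = Suc (Suc m)" "length r = Suc (Suc n)"
    using qr_ne by (metis walk_edges_length)
  have dist: "distinct q" "distinct r" using pathT unfolding path_def by auto
  have start: "q ! 0 = v" "r ! 0 = v" using q(2) r(2) len by (cases q; cases r; simp)+
  have e2: "e2 = {q ! m, q ! Suc m}" and e3: "e3 = {r ! n, r ! Suc n}"
    using q(3) r(3) last_walk_edges len by metis+
  have qT: "{q ! i, q ! Suc i} \<in> edges T" "c {q ! i, q ! Suc i} \<in> {c1, c2}" if "i \<le> m" for i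
    using q(1) that walk_edges_memI[of i q] len unfolding bicoloured_path_def path_def by auto
  have rT: "{r ! i, r ! Suc i} \<in> edges T" "c {r ! i, r ! Suc i} \<in> {c2, c3}" if "i \<le> n" for i
    using r(1) that walk_edges_memI[of i r] len unfolding bicoloured_path_def path_def by auto
  have first: "c {v, q ! Suc 0} = c2" "c {v, r ! Suc 0} = c3"
    using q(1) r(1) hd_walk_edges qr_ne start unfolding bicoloured_path_def by force+
  have vT: "v \<in> verts T" "degree T v = 3" using v(1) by auto
  have l1v: "l1 \<noteq> v"
  proof -
    have "l1 \<in> leaves T" using lv(1) by simp
    then show ?thesis using vT(2) unfolding leaves_def by auto
  qed
  have "card e1 = 2" using SG Seq c2card by auto
  then have e1: "e1 = {v, l1}" using lv(2) v(2) l1v by (auto simp: card_2_iff)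
  \<comment> \<open>The three edges have the colours \<open>c1\<close>, \<open>c2\<close>,
    \<open>c3\<close>, so they are different and, \<open>G\<close> being cubic, all the edges at
    \<open>v\<close>.\<close>
  have at_v: "{e \<in> edges G. v \<in> e} = {e1, {v, q ! Suc 0}, {v, r ! Suc 0}}"
  proof (rule card_subset_eq[symmetric])
    show "finite {e \<in> edges G. v \<in> e}" using fin by simp
    show "{e1, {v, q ! Suc 0}, {v, r ! Suc 0}} \<subseteq> {e \<in> edges G. v \<in> e}"
      using SG Seq v(2) qT(1)[of 0] rT(1)[of 0] TG(2) start by auto
    have "e1 \<noteq> {v, q ! Suc 0}" "e1 \<noteq> {v, r ! Suc 0}" "{v, q ! Suc 0} \<noteq> {v, r ! Suc 0}"
      using ne ce1 first by metis+
    then show "card {e1, {v, q ! Suc 0}, {v, r ! Suc 0}} = card {e \<in> edges G. v \<in> e}"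
      using deg_G[OF vT(1)] by simp
  qed
  \<comment> \<open>All vertices of the path but its last one; position \<open>0\<close> puts
    \<open>v\<close> into both sets.\<close>
  define A where "A = {q ! i | i. i \<le> m}"
  define B where "B = {r ! i | i. i \<le> n}"
  have A_int: "{c1, c2} \<subseteq> c ` {e \<in> edges T. x \<in> e} \<and> x \<in> verts T" if xA: "x \<in> A" "x \<noteq> v" for x
  proof -
    obtain j where j: "j \<le> m" "x = q ! j" using xA A_def by auto
    then obtain i where i: "j = Suc i" using xA(2) start by (cases j) auto
    have "{c {q ! i, q ! Suc i}, c {q ! Suc i, q ! Suc (Suc i)}} = {c1, c2}"
      using interior_colours[OF c pathG(1), of i c1 c2] qT(2)[of i] qT(2)[of "Suc i"] i j len by simp
    moreover have "{{q ! i, q ! Suc i}, {q ! Suc i, q ! Suc (Suc i)}} \<subseteq> {e \<in> edges T. x \<in> e}"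
      using qT(1)[of i] qT(1)[of "Suc i"] i j by auto
    moreover have "x \<in> verts T" using pathT(1) j len unfolding path_def by auto
    ultimately show ?thesis by (metis (no_types, lifting) image_empty image_insert image_mono)
  qed
  have B_int: "{c2, c3} \<subseteq> c ` {e \<in> edges T. x \<in> e} \<and> x \<in> verts T" if xB: "x \<in> B" "x \<noteq> v" for x
  proof -
    obtain j where j: "j \<le> n" "x = r ! j" using xB B_def by auto
    then obtain i where i: "j = Suc i" using xB(2) start by (cases j) auto
    have "{c {r ! i, r ! Suc i}, c {r ! Suc i, r ! Suc (Suc i)}} = {c2, c3}"
      using interior_colours[OF c pathG(2), of i c2 c3] rT(2)[of i] rT(2)[of "Suc i"] i j len by simp
    moreover have "{{r ! i, r ! Suc i}, {r ! Suc i, r ! Suc (Suc i)}} \<subseteq> {e \<in> edges T. x \<in> e}"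
      using rT(1)[of i] rT(1)[of "Suc i"] i j by auto
    moreover have "x \<in> verts T" using pathT(2) j len unfolding path_def by auto
    ultimately show ?thesis by (metis (no_types, lifting) image_empty image_insert image_mono)
  qed
  \<comment> \<open>A common inner vertex would see all three colours in \<open>T\<close>, hence have degree 3.\<close>
  have AB: "x = v" if "x \<in> A" "x \<in> B" for x
  proof (rule ccontr)
    assume "x \<noteq> v"
    with that A_int B_int have "{c1, c2, c3} \<subseteq> c ` {e \<in> edges T. x \<in> e}" "x \<in> verts T" by blast+
    then have "3 \<le> degree T x" using deg_ge[of "{c1, c2, c3}" x] ne by simp
    with \<open>x \<in> verts T\<close> deg_le[of x] v(1) \<open>x \<noteq> v\<close> show False by force
  qed
  \<comment> \<open>A vertex other than \<open>v\<close> in these sets meets two colours in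
    \<open>T\<close>, so its degree there is at least 2.\<close>
  have not_leaf: "x \<notin> leaves T" if "x \<in> A \<union> B" for x
  proof (cases "x = v")
    case True
    then show ?thesis using vT unfolding leaves_def by simp
  next
    case False
    then have "2 \<le> degree T x"
      using that A_int[of x] B_int[of x] deg_ge[of "{c1, c2}" x] deg_ge[of "{c2, c3}" x] ne by auto
    then show ?thesis unfolding leaves_def by simp
  qed
  have "q ! m \<in> A" "r ! n \<in> B" unfolding A_def B_def by auto
  \<comment> \<open>The inner end of \<open>e2\<close> or \<open>e3\<close> is not a leaf, so the
    leaf is the outer end. Being a leaf, it also avoids the other path's set.\<close>
  then have "l2 = q ! Suc m" "l3 = r ! Suc n"
    using not_leaf[of "q ! m"] not_leaf[of "r ! n"] lv e2 e3 by auto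
  then have ends: "l1 \<notin> A \<union> B" "q ! Suc m \<notin> A \<union> B" "r ! Suc n \<notin> A \<union> B"
    using not_leaf lv(1) by blast+
  define \<pi> where "\<pi> x = (if x \<in> B then transpose c2 c3 else id) \<circ> (if x \<in> A then transpose c1 c2 else id)" for x
  have vAB: "v \<in> A" "v \<in> B" using start by (auto simp: A_def B_def intro!: exI[of _ 0])
  have qA: "\<pi> (q ! Suc i) = transpose c1 c2" if "Suc i \<le> m" for i
  proof -
    have "q ! Suc i \<noteq> q ! 0" using that dist len by (simp add: nth_eq_iff_index_eq)
    moreover have "q ! Suc i \<in> A" using that A_def by auto
    ultimately show ?thesis using AB start by (auto simp: \<pi>_def)
  qed
  have rB: "\<pi> (r ! Suc i) = transpose c2 c3" if "Suc i \<le> n" for i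
  proof -
    have "r ! Suc i \<noteq> r ! 0" using that dist len by (simp add: nth_eq_iff_index_eq)
    moreover have "r ! Suc i \<in> B" using that B_def by auto
    ultimately show ?thesis using AB start by (auto simp: \<pi>_def)
  qed
  \<comment> \<open>For \<open>i = 0\<close> both swaps act: \<open>c2\<close> goes to
    \<open>c1\<close>, which the second one fixes. On \<open>r\<close>, dually, \<open>c3\<close> is
    fixed by the first swap and goes to \<open>c2\<close> by the second.\<close>
  have q_edge: "\<pi> (q ! i) (c {q ! i, q ! Suc i}) = transpose c1 c2 (c {q ! i, q ! Suc i})" if "i \<le> m" for i
    using that qA first start vAB ne by (cases i) (auto simp: \<pi>_def transpose_def)
  have r_edge: "\<pi> (r ! i) (c {r ! i, r ! Suc i}) = transpose c2 c3 (c {r ! i, r ! Suc i})" if "i \<le> n" for i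
    using that rB first start vAB ne by (cases i) (auto simp: \<pi>_def transpose_def)
  have fixed: "\<pi> x (c e) = c e"
    if e: "e \<in> edges G" "e \<noteq> e1" "e \<notin> set (walk_edges q)" "e \<notin> set (walk_edges r)" "x \<in> e" for x e
  proof -
    have "{q ! 0, q ! Suc 0} \<in> set (walk_edges q)" "{r ! 0, r ! Suc 0} \<in> set (walk_edges r)"
      using len by (auto simp: set_walk_edges)
    \<comment> \<open>By \<open>at_v\<close>, the edges at \<open>v\<close> are \<open>e1\<close>
      and the first edges of \<open>q\<close> and \<open>r\<close>, all of them excluded
      here.\<close>
    then have xv: "x \<noteq> v" using at_v e start by auto
    have "c e \<notin> {c1, c2}" if xA: "x \<in> A"
    proof -
      obtain j where j: "j \<le> m" "x = q ! j" using xA A_def by auto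
      then obtain i where i: "j = Suc i" using xv start by (cases j) auto
      show ?thesis
        using off_path_colour[OF c pathG(1), of i c1 c2 e] e qT(2)[of i] qT(2)[of "Suc i"] i j len by simp
    qed
    moreover have "c e \<notin> {c2, c3}" if xB: "x \<in> B"
    proof -
      obtain j where j: "j \<le> n" "x = r ! j" using xB B_def by auto
      then obtain i where i: "j = Suc i" using xv start by (cases j) auto
      show ?thesis
        using off_path_colour[OF c pathG(2), of i c2 c3 e] e rT(2)[of i] rT(2)[of "Suc i"] i j len by simp
    qed
    ultimately show ?thesis by (auto simp: \<pi>_def transpose_def)
  qed
  have e1l: "\<pi> v (c e1) = c3" "\<pi> l1 (c e1) = c1"
    using vAB ends ce1 ne by (auto simp: \<pi>_def)
  have e2l: "\<pi> (q ! m) (c e2) = transpose c1 c2 (c e2)" "\<pi> (q ! Suc m) (c e2) = c e2"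
    using q_edge[of m] ends e2 by (auto simp: \<pi>_def)
  have e3l: "\<pi> (r ! n) (c e3) = transpose c2 c3 (c e3)" "\<pi> (r ! Suc n) (c e3) = c e3"
    using r_edge[of n] ends e3 by (auto simp: \<pi>_def)
  have ce: "c e2 \<in> {c1, c2}" "c e3 \<in> {c2, c3}" using qT(2)[of m] rT(2)[of n] e2 e3 by auto
  show ?thesis
  \<comment> \<open>The halves use \<open>{c1, c3}\<close> for \<open>e1\<close>,
    \<open>{c1, c2}\<close> for \<open>e2\<close> and \<open>{c2, c3}\<close> for \<open>e3\<close>;
    the hub edges get the missing colours.\<close>
  proof (rule tripod_colourableI[OF c SG, where \<pi> = \<pi>
        and d = "\<lambda>e. if e = e1 then c2 else if e = e2 then c3 else c1"])
    show "{} \<notin> edges G" using c2card by force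
    show "bij_betw (\<pi> x) {1,2,3} {1,2,3}" for x unfolding \<pi>_def by (rule bij_betw_transposes[OF cs])
    show "\<pi> x (c e) = \<pi> y (c e)" if e: "e \<in> edges G - S" "x \<in> e" "y \<in> e" for e x y
    proof -
      have "\<exists>i<m. e = {q ! i, q ! Suc i}" if w: "e \<in> set (walk_edges q)"
      proof -
        obtain i where i: "Suc i < length q" "e = {q ! i, q ! Suc i}"
          using w unfolding set_walk_edges by blast
        moreover have "i \<noteq> m" using i e(1) Seq e2 by blast
        ultimately show ?thesis using len by (metis Suc_less_eq less_antisym)
      qed
      moreover have "\<exists>i<n. e = {r ! i, r ! Suc i}" if w: "e \<in> set (walk_edges r)"
      proof -
        obtain i where i: "Suc i < length r" "e = {r ! i, r ! Suc i}"
          using w unfolding set_walk_edges by blast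
        moreover have "i \<noteq> n" using i e(1) Seq e3 by blast
        ultimately show ?thesis using len by (metis Suc_less_eq less_antisym)
      qed
      ultimately consider i where "i < m" "e = {q ! i, q ! Suc i}" | i where "i < n" "e = {r ! i, r ! Suc i}"
        | "e \<notin> set (walk_edges q)" "e \<notin> set (walk_edges r)"
        by blast
      then show ?thesis
      proof cases
        case (1 i)
        \<comment> \<open>For \<open>i = 0\<close> the permutations at the two ends differ, but they
          agree on the colour of this edge.\<close>
        then have "\<pi> (q ! i) (c e) = \<pi> (q ! Suc i) (c e)" using q_edge[of i] qA[of i] by simp
        then show ?thesis using e 1 by auto
      next
        case (2 i)
        then have "\<pi> (r ! i) (c e) = \<pi> (r ! Suc i) (c e)" using r_edge[of i] rB[of i] by simp
        then show ?thesis using e 2 by auto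
      next
        case 3
        then show ?thesis using fixed e Seq by auto
      qed
    qed
    show "\<pi> x (c e) \<noteq> \<pi> y (c e)" if e: "e \<in> S" "x \<in> e" "y \<in> e" "x \<noteq> y" for e x y
    proof -
      consider "e = e1" | "e = e2" | "e = e3" using e(1) Seq by auto
      then show ?thesis
      proof cases
        case 1
        then have "{x, y} = {v, l1}" using e e1 by auto
        then show ?thesis using e1l 1 ne by (auto simp: doubleton_eq_iff)
      next
        case 2
        then have "{x, y} = {q ! m, q ! Suc m}" using e e2 by auto
        then show ?thesis using e2l ce 2 ne by (auto simp: doubleton_eq_iff)
      next
        case 3
        then have "{x, y} = {r ! n, r ! Suc n}" using e e3 by auto
        then show ?thesis using e3l ce 3 ne by (auto simp: doubleton_eq_iff)
      qed
    qed
    show "\<pi> x (c e) \<noteq> (if e = e1 then c2 else if e = e2 then c3 else c1)"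
      if e: "e \<in> S" "x \<in> e" for e x
    proof -
      consider "e = e1" "x = v \<or> x = l1" | "e = e2" "x = q ! m \<or> x = q ! Suc m"
        | "e = e3" "x = r ! n \<or> x = r ! Suc n" using e Seq e1 e2 e3 by blast
      then show ?thesis using e1l e2l e3l ce ne en by cases auto
    qed
    show "inj_on (\<lambda>e. if e = e1 then c2 else if e = e2 then c3 else c1) S"
      using Seq ne by (auto simp: inj_on_def)
    show "(\<lambda>e. if e = e1 then c2 else if e = e2 then c3 else c1) ` S \<subseteq> {1,2,3}"
      using cs by auto
  qed
qed

theorem theorem6:
  fixes G :: "'a graph" and c :: "'a set \<Rightarrow> nat" and S :: "'a set set"
  assumes "cubic_graph G"
    and "three_edge_colouring G c"
    and "edge_triple G S"
    and "(\<exists>p. prune_path G c S p) \<or> (\<exists>T. prune_tree G c S T)"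
  shows "three_edge_colourable (tripod G S)"
  using assms prune_path_colourable prune_tree_colourable unfolding cubic_graph_def by metis

end
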